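(* Every completely distributive CSL algebra has the trivial intersection property. That is, if $\mathcal{L}$ is a completely distributive commutative subspace lattice acting on a Hilbert space $\mathcal{H}$, then $\mathrm{Alg}(\mathcal{L})$ has the trivial intersection property.
   Context: A commutative subspace lattice (CSL) on $\mathcal{H}$ is a complete sublattice $\mathcal{L}$ of the lattice of (orthogonal) projections on $\mathcal{H}$ (closed under arbitrary joins and meets), whose elements commute with each other and which contains $0$ and $I$. Its CSL algebra is $\mathrm{Alg}(\mathcal{L})=\{T\in B(\mathcal{H}): P^\perp TP=0\text{ for each }P\in\mathcal{L}\}$, where $P^\perp=I-P$. The CSL algebra is called completely distributive when $\mathcal{L}$ is a completely distributive lattice, in the usual sense: arbitrary meets distribute over arbitrary joins, i.e. $\bigwedge_{i}\bigvee_{j\in J_i}x_{i,j}=\bigvee_{f\in\prod_i J_i}\bigwedge_i x_{i,f(i)}$ for all families in $\mathcal{L}$, together with the dual identity. For $\mathcal{U}\subseteq B(\mathcal{H})$, $C^*(\mathcal{U})$ is the $C^*$-subalgebra of $B(\mathcal{H})$ generated by $\mathcal{U}$. A closed subspace $\mathcal{U}\subseteq B(\mathcal{H})$ has the trivial intersection property if for every closed two-sided ideal $J$ of $C^*(\mathcal{U})$, $\mathcal{U}\cap J=\{0\}$ implies $J=\{0\}$. *)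

theory Defs
  imports "HOL-Analysis.Analysis" "HOL-Algebra.Complete_Lattice"
begin

text \<open>Complex Hilbert spaces. The libraries only have real inner product spaces, so the complex
  structure is added on top of them: the real inner product is the real part of the complex one,
  and hence norm, topology and completeness are the ones of the library.\<close>

class complex_vector = real_vector +
  fixes scaleC :: "complex \<Rightarrow> 'a \<Rightarrow> 'a" (infixr \<open>*\<^sub>C\<close> 75)
  assumes scaleC_add_right: "c *\<^sub>C (x + y) = c *\<^sub>C x + c *\<^sub>C y"
    and scaleC_add_left: "(c + d) *\<^sub>C x = c *\<^sub>C x + d *\<^sub>C x"
    and scaleC_scaleC: "c *\<^sub>C d *\<^sub>C x = (c * d) *\<^sub>C x"
    and scaleR_scaleC: "r *\<^sub>R x = complex_of_real r *\<^sub>C x"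

class complex_normed_vector = complex_vector + real_normed_vector +
  assumes norm_scaleC: "norm (c *\<^sub>C x) = cmod c * norm x"

class complex_inner = complex_vector + real_inner +
  fixes cinner :: "'a \<Rightarrow> 'a \<Rightarrow> complex"
  assumes cinner_commute: "cinner x y = cnj (cinner y x)"
    and cinner_add_left: "cinner (x + y) z = cinner x z + cinner y z"
    and cinner_scaleC_left: "cinner (c *\<^sub>C x) y = c * cinner x y"
    and inner_eq_Re_cinner: "inner x y = Re (cinner x y)"
begin

lemma cinner_add_right: "cinner x (y + z) = cinner x y + cinner x z"
  by (metis cinner_add_left cinner_commute complex_cnj_add)

lemma cinner_scaleC_right: "cinner x (c *\<^sub>C y) = cnj c * cinner x y"
  by (metis cinner_commute cinner_scaleC_left complex_cnj_mult)

subclass complex_normed_vector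
proof
  fix c :: complex and x :: 'a
  have "inner (c *\<^sub>C x) (c *\<^sub>C x) = Re ((c * cnj c) * cinner x x)"
    by (simp only: inner_eq_Re_cinner cinner_scaleC_left cinner_scaleC_right mult_ac)
  also have "c * cnj c = complex_of_real ((cmod c)\<^sup>2)"
    by (simp only: complex_norm_square)
  finally have "inner (c *\<^sub>C x) (c *\<^sub>C x) = (cmod c)\<^sup>2 * inner x x"
    by (simp add: inner_eq_Re_cinner)
  then show "norm (c *\<^sub>C x) = cmod c * norm x"
    by (simp add: norm_eq_sqrt_inner real_sqrt_mult)
qed

end

class chilbert_space = complex_inner + complete_space

instantiation complex :: chilbert_space
begin

definition scaleC_complex :: "complex \<Rightarrow> complex \<Rightarrow> complex" where
  "scaleC_complex c x = c * x"

definition cinner_complex :: "complex \<Rightarrow> complex \<Rightarrow> complex" where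
  "cinner_complex x y = x * cnj y"

instance
  by standard
    (auto simp: scaleC_complex_def cinner_complex_def algebra_simps scaleR_conv_of_real
      inner_complex_def)

end

instantiation blinfun :: (real_normed_vector, complex_normed_vector) complex_vector
begin

lift_definition scaleC_blinfun :: "complex \<Rightarrow> 'a \<Rightarrow>\<^sub>L 'b \<Rightarrow> 'a \<Rightarrow>\<^sub>L 'b"
  is "\<lambda>c f x. c *\<^sub>C f x"
proof -
  fix c :: complex and f :: "'a \<Rightarrow> 'b"
  assume f: "bounded_linear f"
  have "bounded_linear (\<lambda>y::'b. c *\<^sub>C y)"
    by (rule bounded_linear_intro[where K = "cmod c"])
      (simp_all add: scaleC_add_right scaleR_scaleC scaleC_scaleC mult.commute norm_scaleC)
  then show "bounded_linear (\<lambda>x. c *\<^sub>C f x)"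
    using f by (rule bounded_linear_compose)
qed

instance
  by standard
    (transfer, simp add: fun_eq_iff scaleC_add_right scaleC_add_left scaleC_scaleC scaleR_scaleC)+

end

definition csubspace :: "'a::complex_vector set \<Rightarrow> bool" where
  "csubspace S \<longleftrightarrow> 0 \<in> S \<and> (\<forall>x\<in>S. \<forall>y\<in>S. x + y \<in> S) \<and> (\<forall>c. \<forall>x\<in>S. c *\<^sub>C x \<in> S)"

text \<open>\<open>'a \<Rightarrow>\<^sub>L 'a\<close> is the type of bounded real-linear maps; the algebra B(H) is the set of the
  complex-linear ones among them, with the operator norm of the library and \<open>o\<^sub>L\<close> as product.\<close>

definition bounded_operators :: "('a::complex_inner \<Rightarrow>\<^sub>L 'a) set" where
  "bounded_operators = {T. \<forall>c x. blinfun_apply T (c *\<^sub>C x) = c *\<^sub>C blinfun_apply T x}"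

text \<open>Only used for members of \<open>bounded_operators\<close> on a Hilbert space, where existence is the Riesz
  representation theorem.\<close>

definition adj :: "('a::chilbert_space \<Rightarrow>\<^sub>L 'a) \<Rightarrow> 'a \<Rightarrow>\<^sub>L 'a" where
  "adj T = (THE S. \<forall>x y. cinner (blinfun_apply T x) y = cinner x (blinfun_apply S y))"

lemma adj_eqI:
  assumes "\<And>x y. cinner (blinfun_apply T x) y = cinner x (blinfun_apply S y)"
  shows "adj T = S"
  unfolding adj_def
proof (rule the_equality)
  fix S'
  assume S': "\<forall>x y. cinner (blinfun_apply T x) y = cinner x (blinfun_apply S' y)"
  have "inner x (blinfun_apply S' y) = inner x (blinfun_apply S y)" for x y
    using S' assms by (simp add: inner_eq_Re_cinner)
  then have "blinfun_apply S' y = blinfun_apply S y" for y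
    by (intro vector_eq_ldot[THEN iffD1]) simp
  then show "S' = S"
    by (rule blinfun_eqI)
qed (use assms in blast)

definition projections :: "('a::chilbert_space \<Rightarrow>\<^sub>L 'a) set" where
  "projections = {P \<in> bounded_operators. P o\<^sub>L P = P \<and> adj P = P}"

definition projection_lattice :: "('a::chilbert_space \<Rightarrow>\<^sub>L 'a) gorder" where
  "projection_lattice =
    \<lparr>carrier = projections, eq = (=),
     le = (\<lambda>P Q. range (blinfun_apply P) \<subseteq> range (blinfun_apply Q))\<rparr>"

text \<open>Joins and meets are those of the lattice of all projections. Since \<open>\<L>\<close> is closed under
  them, they agree with those of \<open>\<L>\<close> as a lattice in its own right,
  \<open>projection_lattice\<lparr>carrier := \<L>\<rparr>\<close>.\<close>

definition commutative_subspace_lattice :: "('a::chilbert_space \<Rightarrow>\<^sub>L 'a) set \<Rightarrow> bool" where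
  "commutative_subspace_lattice \<L> \<longleftrightarrow>
     \<L> \<subseteq> projections \<and>
     (\<forall>A. A \<subseteq> \<L> \<longrightarrow> \<Squnion>\<^bsub>projection_lattice\<^esub>A \<in> \<L> \<and> \<Sqinter>\<^bsub>projection_lattice\<^esub>A \<in> \<L>) \<and>
     (\<forall>P\<in>\<L>. \<forall>Q\<in>\<L>. P o\<^sub>L Q = Q o\<^sub>L P) \<and>
     0 \<in> \<L> \<and> id_blinfun \<in> \<L>"

text \<open>A definition cannot quantify over index types. Families indexed by sets of elements of the
  lattice are enough: \<open>completely_distributive_families\<close> below derives both laws for
  arbitrary index types.\<close>

definition completely_distributive :: "'b gorder \<Rightarrow> bool" where
  "completely_distributive L \<longleftrightarrow>
     complete_lattice L \<and>
     (\<forall>(I :: 'b set set) (J :: 'b set \<Rightarrow> 'b set) (x :: 'b set \<Rightarrow> 'b \<Rightarrow> 'b).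
        (\<forall>i\<in>I. \<forall>j\<in>J i. x i j \<in> carrier L) \<longrightarrow>
        \<Sqinter>\<^bsub>L\<^esub>((\<lambda>i. \<Squnion>\<^bsub>L\<^esub>(x i ` J i)) ` I) = \<Squnion>\<^bsub>L\<^esub>((\<lambda>f. \<Sqinter>\<^bsub>L\<^esub>((\<lambda>i. x i (f i)) ` I)) ` Pi\<^sub>E I J) \<and>
        \<Squnion>\<^bsub>L\<^esub>((\<lambda>i. \<Sqinter>\<^bsub>L\<^esub>(x i ` J i)) ` I) = \<Sqinter>\<^bsub>L\<^esub>((\<lambda>f. \<Squnion>\<^bsub>L\<^esub>((\<lambda>i. x i (f i)) ` I)) ` Pi\<^sub>E I J))"

context complete_lattice
begin

lemma Inf_Sup_families:
  fixes I :: "'i set" and J :: "'i \<Rightarrow> 'j set" and x :: "'i \<Rightarrow> 'j \<Rightarrow> 'a"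
  assumes x: "\<And>i j. i \<in> I \<Longrightarrow> j \<in> J i \<Longrightarrow> x i j \<in> carrier L"
    and dist: "\<And>\<A>. (\<And>A. A \<in> \<A> \<Longrightarrow> A \<subseteq> carrier L) \<Longrightarrow>
      \<Sqinter>((\<lambda>A. \<Squnion>A) ` \<A>) = \<Squnion>((\<lambda>f. \<Sqinter>(f ` \<A>)) ` Pi\<^sub>E \<A> (\<lambda>A. A))"
  shows "\<Sqinter>((\<lambda>i. \<Squnion>(x i ` J i)) ` I) = \<Squnion>((\<lambda>f. \<Sqinter>((\<lambda>i. x i (f i)) ` I)) ` Pi\<^sub>E I J)"
proof -
  define R where "R i = x i ` J i" for i
  define \<A> where "\<A> = R ` I"
  let ?F = "(\<lambda>f. \<Sqinter>((\<lambda>i. x i (f i)) ` I)) ` Pi\<^sub>E I J"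
  let ?G = "(\<lambda>f. \<Sqinter>(f ` \<A>)) ` Pi\<^sub>E \<A> (\<lambda>A. A)"
  let ?l = "\<Sqinter>((\<lambda>i. \<Squnion>(x i ` J i)) ` I)"
  have R: "R i \<subseteq> carrier L" if "i \<in> I" for i
    using x that by (auto simp: R_def)
  have l: "(\<lambda>i. \<Squnion>(x i ` J i)) ` I \<subseteq> carrier L"
    using R by (auto simp: R_def)
  have xf: "(\<lambda>i. x i (f i)) ` I \<subseteq> carrier L" if "f \<in> Pi\<^sub>E I J" for f
    using x that by (auto dest: PiE_mem)
  have F: "?F \<subseteq> carrier L"
    using xf by auto
  have gA: "g ` \<A> \<subseteq> carrier L" if "g \<in> Pi\<^sub>E \<A> (\<lambda>A. A)" for g
    using R that by (auto simp: \<A>_def dest!: PiE_mem)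
  have G: "?G \<subseteq> carrier L"
    using gA by auto
  have "\<Squnion>?F \<sqsubseteq> ?l"
  proof (rule sup_least)
    fix y assume "y \<in> ?F"
    then obtain f where f: "f \<in> Pi\<^sub>E I J" and y: "y = \<Sqinter>((\<lambda>i. x i (f i)) ` I)" by auto
    have yc: "y \<in> carrier L" using y xf[OF f] by simp
    have "y \<sqsubseteq> \<Squnion>(x i ` J i)" if i: "i \<in> I" for i
    proof -
      have m: "x i (f i) \<in> x i ` J i" using f i by (auto dest: PiE_mem)
      have "y \<sqsubseteq> x i (f i)" unfolding y using i xf[OF f] by (intro inf_lower) auto
      moreover have "x i (f i) \<sqsubseteq> \<Squnion>(x i ` J i)"
        using R[OF i] m by (intro sup_upper) (auto simp: R_def)
      ultimately show ?thesis
      proof (rule le_trans)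
        show "x i (f i) \<in> carrier L" using m R[OF i] by (auto simp: R_def)
        show "\<Squnion>(x i ` J i) \<in> carrier L" using R[OF i] by (simp add: R_def)
      qed (rule yc)
    qed
    then show "y \<sqsubseteq> ?l" using l yc by (intro inf_greatest) auto
  qed (use F l in auto)
  moreover have "?l \<sqsubseteq> \<Squnion>?F"
  proof -
    have "?l = \<Sqinter>((\<lambda>A. \<Squnion>A) ` \<A>)"
      by (simp add: \<A>_def R_def image_image)
    also have "\<dots> = \<Squnion>?G"
      by (rule dist) (use R in \<open>auto simp: \<A>_def\<close>)
    finally have eq: "?l = \<Squnion>?G" .
    have "\<Squnion>?G \<sqsubseteq> \<Squnion>?F"
    proof (rule sup_least)
      fix y assume "y \<in> ?G"
      then obtain g where g: "g \<in> Pi\<^sub>E \<A> (\<lambda>A. A)" and y: "y = \<Sqinter>(g ` \<A>)" by auto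
      have "\<forall>i\<in>I. \<exists>j\<in>J i. g (R i) = x i j"
      proof
        fix i assume "i \<in> I"
        then have "g (R i) \<in> R i" using PiE_mem[OF g] by (simp add: \<A>_def)
        then show "\<exists>j\<in>J i. g (R i) = x i j" by (auto simp: R_def)
      qed
      then obtain f where f: "\<And>i. i \<in> I \<Longrightarrow> f i \<in> J i \<and> g (R i) = x i (f i)"
        by metis
      let ?f = "restrict f I"
      have f': "?f \<in> Pi\<^sub>E I J" using f by auto
      have "(\<lambda>i. x i (?f i)) ` I = g ` \<A>"
        using f by (simp add: \<A>_def image_image)
      then have "y \<in> ?F"
        using f' unfolding y by (intro image_eqI[of _ _ ?f]) simp_all
      then show "y \<sqsubseteq> \<Squnion>?F" using F by (intro sup_upper) auto
    qed (use F G in auto)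
    then show ?thesis by (simp add: eq)
  qed
  ultimately show ?thesis
    using F l by (intro le_antisym) auto
qed

end

lemma completely_distributive_families:
  fixes L :: "'b gorder" and I :: "'i set" and J :: "'i \<Rightarrow> 'j set" and x :: "'i \<Rightarrow> 'j \<Rightarrow> 'b"
  assumes L: "completely_distributive L"
    and x: "\<And>i j. i \<in> I \<Longrightarrow> j \<in> J i \<Longrightarrow> x i j \<in> carrier L"
  shows "\<Sqinter>\<^bsub>L\<^esub>((\<lambda>i. \<Squnion>\<^bsub>L\<^esub>(x i ` J i)) ` I) = \<Squnion>\<^bsub>L\<^esub>((\<lambda>f. \<Sqinter>\<^bsub>L\<^esub>((\<lambda>i. x i (f i)) ` I)) ` Pi\<^sub>E I J)"
    and "\<Squnion>\<^bsub>L\<^esub>((\<lambda>i. \<Sqinter>\<^bsub>L\<^esub>(x i ` J i)) ` I) = \<Sqinter>\<^bsub>L\<^esub>((\<lambda>f. \<Squnion>\<^bsub>L\<^esub>((\<lambda>i. x i (f i)) ` I)) ` Pi\<^sub>E I J)"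
proof -
  interpret L: complete_lattice L
    using L by (simp add: completely_distributive_def)
  have "complete_lattice (inv_gorder L)"
    using partial_order.dual_order[OF L.partial_order_axioms] L.sup_exists L.inf_exists
    by (simp add: complete_lattice_def complete_lattice_axioms_def)
  then interpret D: complete_lattice "inv_gorder L" .
  have d: "\<Sqinter>\<^bsub>L\<^esub>((\<lambda>A. \<Squnion>\<^bsub>L\<^esub>A) ` \<A>) = \<Squnion>\<^bsub>L\<^esub>((\<lambda>f. \<Sqinter>\<^bsub>L\<^esub>(f ` \<A>)) ` Pi\<^sub>E \<A> (\<lambda>A. A)) \<and>
      \<Squnion>\<^bsub>L\<^esub>((\<lambda>A. \<Sqinter>\<^bsub>L\<^esub>A) ` \<A>) = \<Sqinter>\<^bsub>L\<^esub>((\<lambda>f. \<Squnion>\<^bsub>L\<^esub>(f ` \<A>)) ` Pi\<^sub>E \<A> (\<lambda>A. A))"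
    if "\<And>A. A \<in> \<A> \<Longrightarrow> A \<subseteq> carrier L" for \<A>
    using L[unfolded completely_distributive_def, THEN conjunct2, rule_format,
        of \<A> "\<lambda>A. A" "\<lambda>_ b. b"] that
    by auto
  show "\<Sqinter>\<^bsub>L\<^esub>((\<lambda>i. \<Squnion>\<^bsub>L\<^esub>(x i ` J i)) ` I) = \<Squnion>\<^bsub>L\<^esub>((\<lambda>f. \<Sqinter>\<^bsub>L\<^esub>((\<lambda>i. x i (f i)) ` I)) ` Pi\<^sub>E I J)"
    by (rule L.Inf_Sup_families) (use x d in auto)
  show "\<Squnion>\<^bsub>L\<^esub>((\<lambda>i. \<Sqinter>\<^bsub>L\<^esub>(x i ` J i)) ` I) = \<Sqinter>\<^bsub>L\<^esub>((\<lambda>f. \<Squnion>\<^bsub>L\<^esub>((\<lambda>i. x i (f i)) ` I)) ` Pi\<^sub>E I J)"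
    by (rule D.Inf_Sup_families[unfolded sup_dual inf_dual]) (use x d in auto)
qed

definition Alg :: "('a::chilbert_space \<Rightarrow>\<^sub>L 'a) set \<Rightarrow> ('a \<Rightarrow>\<^sub>L 'a) set" where
  "Alg \<L> = {T \<in> bounded_operators. \<forall>P\<in>\<L>. (id_blinfun - P) o\<^sub>L T o\<^sub>L P = 0}"

definition cstar_subalgebra :: "('a::chilbert_space \<Rightarrow>\<^sub>L 'a) set \<Rightarrow> bool" where
  "cstar_subalgebra A \<longleftrightarrow>
     A \<subseteq> bounded_operators \<and> csubspace A \<and> closed A \<and>
     (\<forall>S\<in>A. \<forall>T\<in>A. S o\<^sub>L T \<in> A) \<and> (\<forall>T\<in>A. adj T \<in> A)"

definition cstar_generated :: "('a::chilbert_space \<Rightarrow>\<^sub>L 'a) set \<Rightarrow> ('a \<Rightarrow>\<^sub>L 'a) set" where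
  "cstar_generated \<U> = \<Inter>{A. cstar_subalgebra A \<and> \<U> \<subseteq> A}"

definition closed_ideal :: "('a::chilbert_space \<Rightarrow>\<^sub>L 'a) set \<Rightarrow> ('a \<Rightarrow>\<^sub>L 'a) set \<Rightarrow> bool" where
  "closed_ideal J A \<longleftrightarrow>
     J \<subseteq> A \<and> csubspace J \<and> closed J \<and> (\<forall>a\<in>A. \<forall>b\<in>J. a o\<^sub>L b \<in> J \<and> b o\<^sub>L a \<in> J)"

definition trivial_intersection_property :: "('a::chilbert_space \<Rightarrow>\<^sub>L 'a) set \<Rightarrow> bool" where
  "trivial_intersection_property \<U> \<longleftrightarrow>
     \<U> \<subseteq> bounded_operators \<and> csubspace \<U> \<and> closed \<U> \<and>
     (\<forall>J. closed_ideal J (cstar_generated \<U>) \<longrightarrow> \<U> \<inter> J = {0} \<longrightarrow> J = {0})"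

end

theory Submission
  imports Defs
begin

text \<open>For \<open>E \<in> \<L>\<close> let \<open>E\<^sub>-\<close> be the join of all \<open>Q \<in> \<L>\<close> with \<open>\<not> E \<le> Q\<close>. Whenever \<open>x\<close> lies in
  \<open>E\<close> and \<open>y\<close> is orthogonal to \<open>E\<^sub>-\<close>, the rank-one operator \<open>a = x \<otimes> y\<^sup>*\<close> belongs to \<open>Alg \<L>\<close>:
  every \<open>Q \<in> \<L>\<close> either lies above \<open>E\<close> and fixes \<open>x\<close>, or lies below \<open>E\<^sub>-\<close> and kills \<open>y\<close>
  (\<open>rank_one_in_Alg\<close>).

  Let \<open>J\<close> be an ideal of the generated C*-algebra that meets \<open>Alg \<L>\<close> only in \<open>0\<close>, and let
  \<open>T \<in> J\<close>. Then \<open>a a\<^sup>* (T\<^sup>* T) a\<close> is again in \<open>J\<close>, but it is also the multiple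
  \<open>\<parallel>y\<parallel>\<^sup>2 \<parallel>T x\<parallel>\<^sup>2\<close> of \<open>a\<close>, hence in \<open>Alg \<L>\<close>, hence \<open>0\<close>. So \<open>T x = 0\<close> as soon as
  a nonzero \<open>y\<close> is available (\<open>ideal_annihilates_rank_one_range\<close>): \<open>T\<close> vanishes on every
  \<open>E \<in> \<L>\<close> with \<open>E\<^sub>- \<noteq> I\<close>.

  Complete distributivity says that these \<open>E\<close> have join \<open>I\<close>
  (\<open>completely_distributive_top_join\<close>). The kernel of \<open>T\<close> is a closed subspace that contains all
  of them, and joins in \<open>\<L>\<close> are joins of projections, that is, closed linear spans. So the kernel
  is the whole space and \<open>T = 0\<close>.

  The remaining input is the basic geometry of Hilbert spaces: orthogonal projections onto closed
  subspaces, which give the joins, and the Riesz representation theorem, which gives adjoints.\<close>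

section \<open>Orthogonal projections and adjoints\<close>

text \<open>Moving from the minimiser \<open>p\<close> by \<open>t *\<^sub>R s\<close> changes the squared distance by
  \<open>t\<^sup>2 \<parallel>s\<parallel>\<^sup>2 - 2 t \<langle>x - p, s\<rangle>\<close>, and this is negative for a suitable \<open>t\<close> unless
  \<open>x - p\<close> is orthogonal to \<open>s\<close>.\<close>

lemma nearest_point_orthogonal:
  fixes p x :: "'a::real_inner"
  assumes S: "subspace S" and p: "p \<in> S" and s: "s \<in> S"
    and min: "\<And>q. q \<in> S \<Longrightarrow> (norm (x - p))\<^sup>2 \<le> (norm (x - q))\<^sup>2"
  shows "inner (x - p) s = 0"
proof (cases "s = 0")
  case False
  define t where "t = inner (x - p) s / inner s s"
  have ss: "inner s s > 0"
    using False by simp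
  have "p + t *\<^sub>R s \<in> S"
    using S p s by (simp add: subspace_add subspace_scale)
  from min[OF this] have "inner (x - p) (x - p) \<le> inner (x - p - t *\<^sub>R s) (x - p - t *\<^sub>R s)"
    by (simp add: power2_norm_eq_inner diff_diff_add)
  also have "\<dots> = inner (x - p) (x - p) - 2 * t * inner (x - p) s + t * (t * inner s s)"
    by (simp add: inner_diff_left inner_diff_right inner_commute algebra_simps)
  also have "t * inner s s = inner (x - p) s"
    using ss by (simp add: t_def)
  finally have "t * inner (x - p) s \<le> 0"
    by simp
  then have "(inner (x - p) s)\<^sup>2 / inner s s \<le> 0"
    by (simp add: t_def power2_eq_square)
  then show ?thesis
    using ss by (simp add: divide_le_0_iff)
qed simp

text \<open>A sequence in \<open>S\<close> whose distance to \<open>x\<close> tends to the infimum is Cauchy by the parallelogram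
  law, since midpoints stay in \<open>S\<close>; its limit is a nearest point.\<close>

lemma closed_subspace_orthogonal_decomposition:
  fixes x :: "'a::{real_inner, complete_space}"
  assumes S: "subspace S" and cl: "closed S"
  shows "\<exists>p\<in>S. \<forall>s\<in>S. inner (x - p) s = 0"
proof -
  let ?D = "(\<lambda>s. (norm (x - s))\<^sup>2) ` S"
  define d where "d = Inf ?D"
  have bdd: "bdd_below ?D"
    by (rule bdd_belowI[of _ 0]) auto
  have ne: "?D \<noteq> {}"
    using subspace_0[OF S] by blast
  have d_le: "d \<le> (norm (x - s))\<^sup>2" if "s \<in> S" for s
    unfolding d_def using that by (intro cInf_lower bdd) auto
  have "\<exists>s\<in>S. (norm (x - s))\<^sup>2 < d + 1 / real (Suc n)" for n
    using cInf_lessD[OF ne, of "d + 1 / real (Suc n)"] by (auto simp: d_def)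
  then obtain s where s: "\<And>n. s n \<in> S" "\<And>n. (norm (x - s n))\<^sup>2 < d + 1 / real (Suc n)"
    by metis
  have close: "(norm (s m - s n))\<^sup>2 \<le> 2 / real (Suc m) + 2 / real (Suc n)" for m n
  proof -
    let ?c = "(1/2) *\<^sub>R (s m + s n)"
    have "?c \<in> S"
      using S s by (simp add: subspace_add subspace_scale)
    then have "d \<le> (norm (x - ?c))\<^sup>2"
      by (rule d_le)
    \<comment> \<open>the parallelogram law for \<open>x - s m\<close> and \<open>x - s n\<close>\<close>
    moreover have "(norm (s m - s n))\<^sup>2
        = 2 * (norm (x - s m))\<^sup>2 + 2 * (norm (x - s n))\<^sup>2 - 4 * (norm (x - ?c))\<^sup>2"
      by (simp add: power2_norm_eq_inner inner_diff_left inner_diff_right inner_add_left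
          inner_add_right inner_commute algebra_simps)
    ultimately show ?thesis
      using s(2)[of m] s(2)[of n] by simp
  qed
  have "Cauchy s"
  proof (rule CauchyI)
    fix e :: real
    assume e: "0 < e"
    then obtain N where N: "4 / e\<^sup>2 < real N"
      using reals_Archimedean2 by blast
    show "\<exists>M. \<forall>m\<ge>M. \<forall>n\<ge>M. norm (s m - s n) < e"
    proof (intro exI allI impI)
      fix m n
      assume mn: "N \<le> m" "N \<le> n"
      have pos: "0 < 4 / e\<^sup>2"
        using e by simp
      have "2 / real (Suc k) < e\<^sup>2 / 2" if "N \<le> k" for k
      proof -
        have "4 / e\<^sup>2 < real (Suc k)"
          using N that by linarith
        then show ?thesis
          using e by (simp add: field_simps)
      qed
      from this[OF mn(1)] this[OF mn(2)] have "(norm (s m - s n))\<^sup>2 < e\<^sup>2"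
        using close[of m n] by linarith
      then show "norm (s m - s n) < e"
        using e by (simp add: power2_less_imp_less)
    qed
  qed
  then obtain p where lim: "s \<longlonglongrightarrow> p"
    using Cauchy_convergent convergent_def by blast
  have p: "p \<in> S"
    using closed_sequentially[OF cl] s(1) lim by blast
  have "(\<lambda>n. (norm (x - s n))\<^sup>2) \<longlonglongrightarrow> (norm (x - p))\<^sup>2"
    by (intro tendsto_intros lim)
  moreover have "(\<lambda>n. d + 1 / real (Suc n)) \<longlonglongrightarrow> d + 0"
    by (intro tendsto_add tendsto_const lim_1_over_n[THEN LIMSEQ_Suc])
  ultimately have "(norm (x - p))\<^sup>2 \<le> d + 0"
    by (rule LIMSEQ_le) (use s(2) less_imp_le in blast)
  then have "(norm (x - p))\<^sup>2 \<le> (norm (x - q))\<^sup>2" if "q \<in> S" for q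
    using d_le[OF that] by linarith
  then show ?thesis
    using nearest_point_orthogonal[OF S p] p by blast
qed

text \<open>A nonzero \<open>w\<close> orthogonal to the kernel of \<open>f\<close> represents \<open>f\<close> up to a scalar, because the
  kernel has codimension one.\<close>

lemma riesz_representation:
  fixes f :: "'a::{real_inner, complete_space} \<Rightarrow> real"
  assumes f: "bounded_linear f"
  shows "\<exists>z. \<forall>x. f x = inner x z"
proof (cases "\<forall>x. f x = 0")
  case True
  then show ?thesis
    by (intro exI[of _ 0]) simp
next
  case False
  then obtain u where u: "f u \<noteq> 0" by blast
  interpret f: bounded_linear f by (rule f)
  let ?K = "{x. f x = 0}"
  have "subspace ?K"
    by (auto simp: subspace_def f.add f.scaleR f.zero)
  moreover have "closed ?K"
    by (intro closed_Collect_eq continuous_intros f.continuous_on)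
  ultimately obtain p where p: "f p = 0" and orth: "\<And>k. f k = 0 \<Longrightarrow> inner (u - p) k = 0"
    using closed_subspace_orthogonal_decomposition[of ?K u] by auto
  define w where "w = u - p"
  have fw: "f w \<noteq> 0"
    using u p by (simp add: w_def f.diff)
  then have ww: "inner w w \<noteq> 0"
    by (auto simp: f.zero)
  have "f x = inner x ((f w / inner w w) *\<^sub>R w)" for x
  proof -
    have "f (x - (f x / f w) *\<^sub>R w) = 0"
      using fw by (simp add: f.diff f.scaleR)
    then have "inner w (x - (f x / f w) *\<^sub>R w) = 0"
      using orth by (simp add: w_def)
    then have "inner x w = f x / f w * inner w w"
      by (simp add: inner_diff_right inner_commute)
    then show ?thesis
      using fw ww by simp
  qed
  then show ?thesis by blast
qed

text \<open>Orthogonality and representation are obtained for the real inner product. They transfer to the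
  complex one, whose imaginary part is recovered from real parts by \<open>Im c = Re (- \<i> * c)\<close>.\<close>

lemma cinner_eq_if_inner_eq:
  fixes T :: "'a::complex_inner \<Rightarrow> 'b::complex_inner"
  assumes "\<And>c x. T (c *\<^sub>C x) = c *\<^sub>C T x" and "\<And>x. inner (T x) y = inner x z"
  shows "cinner (T x) y = cinner x z"
  using assms(2)[of x] assms(2)[of "- \<i> *\<^sub>C x"]
  by (simp add: assms(1) inner_eq_Re_cinner cinner_scaleC_left complex_eq_iff)

lemma bounded_operatorsD:
  "T \<in> bounded_operators \<Longrightarrow> blinfun_apply T (c *\<^sub>C x) = c *\<^sub>C blinfun_apply T x"
  by (simp add: bounded_operators_def)

lemma cinner_zero_right [simp]: "cinner x 0 = 0"
  using cinner_add_right[of x 0 0] by simp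

lemma cinner_self_eq_0_iff [simp]: "cinner x x = 0 \<longleftrightarrow> x = 0"
proof
  assume "cinner x x = 0"
  then have "inner x x = 0"
    by (simp add: inner_eq_Re_cinner)
  then show "x = 0"
    by simp
qed simp

lemma scaleC_zero_right [simp]: "c *\<^sub>C 0 = 0"
  using scaleC_add_right[of c 0 0] by simp

lemma scaleC_zero_left [simp]: "0 *\<^sub>C x = 0"
  using scaleC_add_left[of 0 0 x] by simp

lemma scaleC_eq_0_iff [simp]: "c *\<^sub>C x = 0 \<longleftrightarrow> c = 0 \<or> x = 0"
  for x :: "'a::complex_normed_vector"
  by (metis norm_scaleC mult_eq_0_iff norm_eq_zero)

lemma csubspace_imp_subspace: "csubspace S \<Longrightarrow> subspace S"
  by (simp add: csubspace_def subspace_def scaleR_scaleC)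

lemma scaleC_right_diff: "c *\<^sub>C (x - y) = c *\<^sub>C x - c *\<^sub>C y"
  using scaleC_add_right[of c "x - y" y] by (simp add: algebra_simps)

text \<open>Apply the Riesz theorem to \<open>x \<mapsto> \<langle>T x, y\<rangle>\<close> for each \<open>y\<close>; uniqueness of the representing vector
  makes it depend linearly on \<open>y\<close>.\<close>

lemma adjoint_exists:
  fixes T :: "'a::chilbert_space \<Rightarrow>\<^sub>L 'a"
  assumes T: "T \<in> bounded_operators"
  shows "\<exists>S\<in>bounded_operators. \<forall>x y. cinner (blinfun_apply T x) y = cinner x (blinfun_apply S y)"
proof -
  have "bounded_linear (\<lambda>x. inner (blinfun_apply T x) y)" for y
    by (intro bounded_linear_intros)
  then have "\<forall>y. \<exists>z. \<forall>x. inner (blinfun_apply T x) y = inner x z"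
    using riesz_representation by blast
  then obtain R where R: "\<And>x y. inner (blinfun_apply T x) y = inner x (R y)"
    by metis
  have cR: "cinner (blinfun_apply T x) y = cinner x (R y)" for x y
    by (rule cinner_eq_if_inner_eq) (simp_all add: R bounded_operatorsD[OF T])
  have uniq: "z = R y" if "\<And>x. inner (blinfun_apply T x) y = inner x z" for y z
    using that by (intro vector_eq_ldot[THEN iffD1]) (simp add: R)
  have "bounded_linear R"
  proof (rule bounded_linear_intro)
    fix y y' :: 'a and r :: real
    show "R (y + y') = R y + R y'"
      by (rule uniq[symmetric]) (simp add: inner_add_right R)
    show "R (r *\<^sub>R y) = r *\<^sub>R R y"
      by (rule uniq[symmetric]) (simp add: R)
    have "norm (R y) * norm (R y) = inner (blinfun_apply T (R y)) y"
      by (simp add: R norm_eq_sqrt_inner)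
    also have "\<dots> \<le> norm (blinfun_apply T (R y)) * norm y"
      by (rule norm_cauchy_schwarz)
    also have "\<dots> \<le> (norm T * norm (R y)) * norm y"
      by (intro mult_right_mono norm_blinfun) simp
    finally have "norm (R y) * norm (R y) \<le> norm (R y) * (norm y * norm T)"
      by (simp add: mult_ac)
    then show "norm (R y) \<le> norm y * norm T"
      by (cases "R y = 0") simp_all
  qed
  then have ap: "blinfun_apply (Blinfun R) = R"
    by (rule bounded_linear_Blinfun_apply)
  have "R (c *\<^sub>C y) = c *\<^sub>C R y" for c y
    by (rule uniq[symmetric])
      (simp add: inner_eq_Re_cinner cinner_scaleC_right cR)
  then have "Blinfun R \<in> bounded_operators"
    by (simp add: bounded_operators_def ap)
  then show ?thesis
    using cR ap by metis
qed

lemma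
  fixes T :: "'a::chilbert_space \<Rightarrow>\<^sub>L 'a"
  assumes T: "T \<in> bounded_operators"
  shows adj_bounded_operators: "adj T \<in> bounded_operators"
    and cinner_adj: "cinner (blinfun_apply T x) y = cinner x (blinfun_apply (adj T) y)"
  using adjoint_exists[OF T] by (metis adj_eqI)+

lemma projection_onto_closed_subspace:
  fixes S :: "'a::chilbert_space set"
  assumes S: "csubspace S" "closed S"
  shows "\<exists>P\<in>projections. range (blinfun_apply P) = S"
proof -
  have sub: "subspace S"
    using S(1) by (rule csubspace_imp_subspace)
  have "\<forall>x. \<exists>p. p \<in> S \<and> (\<forall>s\<in>S. inner (x - p) s = 0)"
    using closed_subspace_orthogonal_decomposition[OF sub S(2)] by blast
  then obtain P where P: "\<And>x. P x \<in> S" "\<And>x s. s \<in> S \<Longrightarrow> inner (x - P x) s = 0"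
    by metis
  have uniq: "q = P x" if q: "q \<in> S" "\<And>s. s \<in> S \<Longrightarrow> inner (x - q) s = 0" for x q
  proof -
    have "q - P x \<in> S"
      using sub q(1) P(1) by (rule subspace_diff)
    then have "inner (x - P x) (q - P x) = 0" "inner (x - q) (q - P x) = 0"
      using P(2) q(2) by blast+
    then have "inner (q - P x) (q - P x) = 0"
      by (simp add: inner_diff_left)
    then show ?thesis
      by simp
  qed
  have PC: "P (c *\<^sub>C x) = c *\<^sub>C P x" for c x
  proof (rule uniq[symmetric])
    show "c *\<^sub>C P x \<in> S"
      using S(1) P(1) by (simp add: csubspace_def)
    fix s assume "s \<in> S"
    then have "cnj c *\<^sub>C s \<in> S"
      using S(1) by (simp add: csubspace_def)
    then have "inner (x - P x) (cnj c *\<^sub>C s) = 0"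
      by (rule P(2))
    then show "inner (c *\<^sub>C x - c *\<^sub>C P x) s = 0"
      by (simp add: inner_eq_Re_cinner cinner_scaleC_right scaleC_right_diff[symmetric]
          cinner_scaleC_left)
  qed
  have "bounded_linear P"
  proof (rule bounded_linear_intro)
    fix x y :: 'a and r :: real
    show "P (x + y) = P x + P y"
    proof (rule uniq[symmetric])
      show "P x + P y \<in> S"
        using sub P(1) by (simp add: subspace_add)
      show "inner (x + y - (P x + P y)) s = 0" if "s \<in> S" for s
        using P(2)[OF that, of x] P(2)[OF that, of y]
        by (simp add: inner_diff_left inner_add_left)
    qed
    show "P (r *\<^sub>R x) = r *\<^sub>R P x"
      by (simp add: scaleR_scaleC PC)
    have "norm (P x) * norm (P x) = inner (P x) (P x)"
      by (simp add: norm_eq_sqrt_inner)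
    also have "\<dots> = inner x (P x)"
      using P(2)[OF P(1), of x x] by (simp add: inner_diff_left)
    also have "\<dots> \<le> norm x * norm (P x)"
      by (rule norm_cauchy_schwarz)
    finally show "norm (P x) \<le> norm x * 1"
      by (cases "P x = 0") simp_all
  qed
  then have ap: "blinfun_apply (Blinfun P) = P"
    by (rule bounded_linear_Blinfun_apply)
  have fix_S: "P s = s" if "s \<in> S" for s
    using uniq[of s s] that by simp
  have bop: "Blinfun P \<in> bounded_operators"
    by (simp add: bounded_operators_def ap PC)
  have "inner (P x) y = inner x (P y)" for x y
    using P(2)[OF P(1)[of x], of y] P(2)[OF P(1)[of y], of x]
    by (simp add: inner_diff_left inner_commute[of y "P x"] inner_diff_right
        inner_commute[of "P y" "P x"])
  then have "cinner (P x) y = cinner x (P y)" for x y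
    by (rule cinner_eq_if_inner_eq[where T = P, OF PC])
  then have "adj (Blinfun P) = Blinfun P"
    by (intro adj_eqI) (simp add: ap)
  moreover have "Blinfun P o\<^sub>L Blinfun P = Blinfun P"
    by (rule blinfun_eqI) (simp add: ap fix_S P(1))
  ultimately have "Blinfun P \<in> projections"
    using bop by (simp add: projections_def)
  moreover have "range P = S"
    using P(1) fix_S by (metis image_subset_iff rangeI subsetI subset_antisym)
  ultimately show ?thesis
    using ap by metis
qed

section \<open>Joins of projections\<close>

lemma projectionsD:
  assumes "P \<in> projections"
  shows "blinfun_apply P (blinfun_apply P x) = blinfun_apply P x"
    and "cinner (blinfun_apply P x) y = cinner x (blinfun_apply P y)"
proof -
  have P: "P \<in> bounded_operators" "P o\<^sub>L P = P" "adj P = P"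
    using assms by (auto simp: projections_def)
  show "blinfun_apply P (blinfun_apply P x) = blinfun_apply P x"
    by (metis P(2) blinfun_apply_blinfun_compose)
  show "cinner (blinfun_apply P x) y = cinner x (blinfun_apply P y)"
    using cinner_adj[OF P(1)] P(3) by simp
qed

lemma projection_range_iff:
  assumes "P \<in> projections"
  shows "x \<in> range (blinfun_apply P) \<longleftrightarrow> blinfun_apply P x = x"
proof
  assume "x \<in> range (blinfun_apply P)"
  then show "blinfun_apply P x = x"
    using projectionsD(1)[OF assms] by auto
next
  assume "blinfun_apply P x = x"
  then show "x \<in> range (blinfun_apply P)"
    using rangeI[of "blinfun_apply P" x] by simp
qed

text \<open>The join in \<open>projection_lattice\<close> is a choice among least upper bounds, so it means something
  only once one exists. The projection onto the smallest closed subspace that contains all the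
  ranges is one.\<close>

lemma
  fixes \<A> :: "('a::chilbert_space \<Rightarrow>\<^sub>L 'a) set"
  assumes \<A>: "\<A> \<subseteq> projections"
  shows projection_lattice_join_upper: "P \<in> \<A> \<Longrightarrow>
      range (blinfun_apply P) \<subseteq> range (blinfun_apply (\<Squnion>\<^bsub>projection_lattice\<^esub>\<A>))"
    and projection_lattice_join_least: "N \<in> projections \<Longrightarrow>
      (\<And>P. P \<in> \<A> \<Longrightarrow> range (blinfun_apply P) \<subseteq> range (blinfun_apply N)) \<Longrightarrow>
      range (blinfun_apply (\<Squnion>\<^bsub>projection_lattice\<^esub>\<A>)) \<subseteq> range (blinfun_apply N)"
proof -
  define \<S> where
    "\<S> = {S::'a set. csubspace S \<and> closed S \<and> (\<forall>P\<in>\<A>. range (blinfun_apply P) \<subseteq> S)}"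
  have "csubspace (\<Inter>\<S>)" "closed (\<Inter>\<S>)"
    by (auto simp: \<S>_def csubspace_def)
  then obtain Q where Q: "Q \<in> projections" "range (blinfun_apply Q) = \<Inter>\<S>"
    using projection_onto_closed_subspace by blast
  have range_closed: "csubspace (range (blinfun_apply R)) \<and> closed (range (blinfun_apply R))"
    if R: "R \<in> projections" for R :: "'a \<Rightarrow>\<^sub>L 'a"
  proof
    have eq: "range (blinfun_apply R) = {x. blinfun_apply R x = x}"
      using projection_range_iff[OF R] by auto
    show "closed (range (blinfun_apply R))"
      unfolding eq by (intro closed_Collect_eq continuous_intros)
    have "R \<in> bounded_operators"
      using R by (simp add: projections_def)
    then show "csubspace (range (blinfun_apply R))"
      unfolding eq by (simp add: csubspace_def blinfun.add_right bounded_operatorsD)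
  qed
  have Upper: "U \<in> Upper projection_lattice \<A> \<longleftrightarrow>
      U \<in> projections \<and> (\<forall>P\<in>\<A>. range (blinfun_apply P) \<subseteq> range (blinfun_apply U))" for U
    using \<A> by (simp add: Upper_def projection_lattice_def) blast
  have Q_upper: "range (blinfun_apply P) \<subseteq> range (blinfun_apply Q)" if "P \<in> \<A>" for P
    unfolding Q(2) using that by (auto simp: \<S>_def)
  have Q_least: "range (blinfun_apply Q) \<subseteq> range (blinfun_apply U)"
    if "U \<in> Upper projection_lattice \<A>" for U
    unfolding Q(2) using that range_closed[of U] Upper[of U]
    by (intro Inter_lower) (simp add: \<S>_def)
  have "least projection_lattice Q (Upper projection_lattice \<A>)"
    unfolding least_def
  proof (intro conjI ballI)
    show "Upper projection_lattice \<A> \<subseteq> carrier projection_lattice"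
      by simp
    show "Q \<in> Upper projection_lattice \<A>"
      using Q(1) Q_upper Upper by blast
    show "Q \<sqsubseteq>\<^bsub>projection_lattice\<^esub> U" if "U \<in> Upper projection_lattice \<A>" for U
      using Q_least[OF that] by (simp add: projection_lattice_def)
  qed
  then have "least projection_lattice (\<Squnion>\<^bsub>projection_lattice\<^esub>\<A>) (Upper projection_lattice \<A>)"
    unfolding Lattice.sup_def by (rule someI)
  then have join: "\<Squnion>\<^bsub>projection_lattice\<^esub>\<A> \<in> Upper projection_lattice \<A>"
      "\<And>U. U \<in> Upper projection_lattice \<A> \<Longrightarrow> \<Squnion>\<^bsub>projection_lattice\<^esub>\<A> \<sqsubseteq>\<^bsub>projection_lattice\<^esub> U"
    by (simp_all only: least_def)
  show "range (blinfun_apply P) \<subseteq> range (blinfun_apply (\<Squnion>\<^bsub>projection_lattice\<^esub>\<A>))" if "P \<in> \<A>"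
    using that join(1) Upper by blast
  show "range (blinfun_apply (\<Squnion>\<^bsub>projection_lattice\<^esub>\<A>)) \<subseteq> range (blinfun_apply N)"
    if "N \<in> projections" "\<And>P. P \<in> \<A> \<Longrightarrow> range (blinfun_apply P) \<subseteq> range (blinfun_apply N)"
    using that join(2)[of N] Upper[of N] by (simp add: projection_lattice_def)
qed

section \<open>Completely distributive lattices\<close>

text \<open>Distribute the meet, over all sets \<open>A\<close> with join \<open>t\<close>, of the joins of the \<open>A\<close>. Its value is
  the top element \<open>t\<close>, so \<open>t\<close> is the join of the meets \<open>E\<close> of choice functions. Such an \<open>E\<close> lies
  below some member of every \<open>A\<close> with join \<open>t\<close>; the set of all \<open>Q\<close> that are not above \<open>E\<close> has no
  such member, so its join is not \<open>t\<close>.\<close>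

lemma completely_distributive_top_join:
  fixes L :: "'b gorder"
  assumes cd: "completely_distributive L"
    and t: "t \<in> carrier L" "\<And>x. x \<in> carrier L \<Longrightarrow> x \<sqsubseteq>\<^bsub>L\<^esub> t"
  shows "\<Squnion>\<^bsub>L\<^esub>{E \<in> carrier L. \<Squnion>\<^bsub>L\<^esub>{Q \<in> carrier L. \<not> E \<sqsubseteq>\<^bsub>L\<^esub> Q} \<noteq> t} = t"
proof -
  interpret complete_lattice L
    using cd by (simp add: completely_distributive_def)
  let ?G = "{E \<in> carrier L. \<Squnion>\<^bsub>L\<^esub>{Q \<in> carrier L. \<not> E \<sqsubseteq>\<^bsub>L\<^esub> Q} \<noteq> t}"
  \<comment> \<open>all ways to write the top element as a join\<close>
  define \<A> where "\<A> = {A. A \<subseteq> carrier L \<and> \<Squnion>\<^bsub>L\<^esub>A = t}"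
  define F where "F = (\<lambda>f. \<Sqinter>\<^bsub>L\<^esub>(f ` \<A>)) ` Pi\<^sub>E \<A> (\<lambda>A. A)"
  have f_carrier: "f ` \<A> \<subseteq> carrier L" if "f \<in> Pi\<^sub>E \<A> (\<lambda>A. A)" for f
    using PiE_mem[OF that] by (auto simp: \<A>_def)
  have "F \<subseteq> ?G"
  proof
    fix E assume "E \<in> F"
    then obtain f where f: "f \<in> Pi\<^sub>E \<A> (\<lambda>A. A)" and E: "E = \<Sqinter>\<^bsub>L\<^esub>(f ` \<A>)"
      by (auto simp: F_def)
    have Ec: "E \<in> carrier L"
      using f_carrier[OF f] E by simp
    let ?A = "{Q \<in> carrier L. \<not> E \<sqsubseteq>\<^bsub>L\<^esub> Q}"
    have "\<Squnion>\<^bsub>L\<^esub>?A \<noteq> t"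
    proof
      assume "\<Squnion>\<^bsub>L\<^esub>?A = t"
      then have A: "?A \<in> \<A>"
        by (auto simp: \<A>_def)
      then have "\<not> E \<sqsubseteq>\<^bsub>L\<^esub> f ?A"
        using PiE_mem[OF f A] by blast
      moreover have "E \<sqsubseteq>\<^bsub>L\<^esub> f ?A"
        using inf_lower[OF f_carrier[OF f] imageI[OF A]] by (simp only: E[symmetric])
      ultimately show False ..
    qed
    then show "E \<in> ?G"
      using Ec by simp
  qed
  have "t \<sqsubseteq>\<^bsub>L\<^esub> \<Sqinter>\<^bsub>L\<^esub>((\<lambda>A. \<Squnion>\<^bsub>L\<^esub>A) ` \<A>)"
    using t by (intro inf_greatest) (auto simp: \<A>_def)
  also have "\<Sqinter>\<^bsub>L\<^esub>((\<lambda>A. \<Squnion>\<^bsub>L\<^esub>A) ` \<A>) = \<Squnion>\<^bsub>L\<^esub>F"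
    unfolding F_def
    using completely_distributive_families(1)[OF cd, of \<A> "\<lambda>A. A" "\<lambda>_ b. b"]
    by (auto simp: \<A>_def)
  finally have "t \<sqsubseteq>\<^bsub>L\<^esub> \<Squnion>\<^bsub>L\<^esub>F" .
  moreover have "\<Squnion>\<^bsub>L\<^esub>F \<sqsubseteq>\<^bsub>L\<^esub> \<Squnion>\<^bsub>L\<^esub>?G"
    using \<open>F \<subseteq> ?G\<close> by (intro sup_least) (auto intro: sup_upper)
  ultimately have "t \<sqsubseteq>\<^bsub>L\<^esub> \<Squnion>\<^bsub>L\<^esub>?G"
    using \<open>F \<subseteq> ?G\<close> t(1)
    by (intro le_trans[of t "\<Squnion>\<^bsub>L\<^esub>F" "\<Squnion>\<^bsub>L\<^esub>?G"] sup_closed) auto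
  then show ?thesis
    using t by (intro le_antisym) auto
qed

section \<open>Rank-one operators\<close>

definition rank_one :: "'a::complex_inner \<Rightarrow> 'a \<Rightarrow> 'a \<Rightarrow>\<^sub>L 'a" where
  "rank_one x y = Blinfun (\<lambda>z. cinner z y *\<^sub>C x)"

text \<open>The complex inequality follows from the real one after \<open>x\<close> is rotated by the phase of
  \<open>cinner x y\<close>.\<close>

lemma norm_cinner_le: "cmod (cinner x y) \<le> norm x * norm y"
proof (cases "cinner x y = 0")
  case False
  define c where "c = cnj (cinner x y) / cmod (cinner x y)"
  have "complex_of_real (cmod (cinner x y)) = c * cinner x y"
    using False by (simp add: c_def complex_norm_square[symmetric] mult.commute power2_eq_square)
  then have "cmod (cinner x y) = Re (cinner (c *\<^sub>C x) y)"
    by (metis Re_complex_of_real cinner_scaleC_left)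
  also have "\<dots> \<le> norm (c *\<^sub>C x) * norm y"
    using norm_cauchy_schwarz[of "c *\<^sub>C x" y] by (simp add: inner_eq_Re_cinner)
  also have "norm (c *\<^sub>C x) = norm x"
    using False by (simp add: norm_scaleC c_def norm_divide)
  finally show ?thesis .
qed simp

lemma rank_one_apply [simp]: "blinfun_apply (rank_one x y) z = cinner z y *\<^sub>C x"
proof -
  have "bounded_linear (\<lambda>z. cinner z y *\<^sub>C x)"
  proof (rule bounded_linear_intro)
    fix z
    show "norm (cinner z y *\<^sub>C x) \<le> norm z * (norm y * norm x)"
      using mult_right_mono[OF norm_cinner_le[of z y], of "norm x"]
      by (simp add: norm_scaleC mult_ac)
  qed (simp_all add: cinner_add_left scaleC_add_left scaleR_scaleC cinner_scaleC_left scaleC_scaleC)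
  then show ?thesis
    by (simp add: rank_one_def bounded_linear_Blinfun_apply)
qed

lemma adj_rank_one: "adj (rank_one x y) = rank_one y x"
proof (rule adj_eqI)
  fix u v
  have "cinner (cinner u y *\<^sub>C x) v = cinner u (cinner v x *\<^sub>C y)"
    using cinner_commute[of x v] by (simp add: cinner_scaleC_left cinner_scaleC_right mult.commute)
  then show "cinner (blinfun_apply (rank_one x y) u) v = cinner u (blinfun_apply (rank_one y x) v)"
    by simp
qed

lemma rank_one_bounded_operators: "rank_one x y \<in> bounded_operators"
  by (simp add: bounded_operators_def cinner_scaleC_left scaleC_scaleC)

text \<open>The alternative makes \<open>Q\<^sup>\<bottom> (x \<otimes> y\<^sup>*) Q = (Q\<^sup>\<bottom> x) \<otimes> (Q y)\<^sup>*\<close> vanish.\<close>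

lemma rank_one_in_Alg:
  assumes \<L>: "\<L> \<subseteq> projections"
    and *: "\<And>Q. Q \<in> \<L> \<Longrightarrow> blinfun_apply Q x = x \<or> blinfun_apply Q y = 0"
  shows "rank_one x y \<in> Alg \<L>"
proof -
  have "(id_blinfun - Q) o\<^sub>L rank_one x y o\<^sub>L Q = 0" if Q: "Q \<in> \<L>" for Q
  proof (rule blinfun_eqI)
    fix z
    have Qp: "Q \<in> projections" "Q \<in> bounded_operators"
      using \<L> Q by (auto simp: projections_def)
    show "blinfun_apply ((id_blinfun - Q) o\<^sub>L rank_one x y o\<^sub>L Q) z = blinfun_apply 0 z"
      using *[OF Q]
      by (auto simp: blinfun.diff_left bounded_operatorsD[OF Qp(2)] projectionsD(2)[OF Qp(1)])
  qed
  then show ?thesis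
    by (simp add: Alg_def rank_one_bounded_operators)
qed

section \<open>The generated C*-algebra\<close>

lemma bounded_linear_scaleC: "bounded_linear (\<lambda>x::'a::complex_normed_vector. c *\<^sub>C x)"
  by (rule bounded_linear_intro[where K = "cmod c"])
    (simp_all add: scaleC_add_right scaleR_scaleC scaleC_scaleC mult.commute norm_scaleC)

lemma closed_bounded_operators: "closed (bounded_operators :: ('a::complex_inner \<Rightarrow>\<^sub>L 'a) set)"
proof -
  have "continuous_on UNIV (\<lambda>T::'a \<Rightarrow>\<^sub>L 'a. c *\<^sub>C blinfun_apply T x)" for c x
    using bounded_linear_compose[OF bounded_linear_scaleC blinfun.bounded_linear_left]
    by (rule linear_continuous_on)
  then have "closed {T::'a \<Rightarrow>\<^sub>L 'a. \<forall>c x. blinfun_apply T (c *\<^sub>C x) = c *\<^sub>C blinfun_apply T x}"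
    by (intro closed_Collect_all closed_Collect_eq continuous_intros)
  then show ?thesis
    by (simp add: bounded_operators_def)
qed

lemma scaleC_blinfun_apply [simp]: "blinfun_apply (c *\<^sub>C T) x = c *\<^sub>C blinfun_apply T x"
  by (simp add: scaleC_blinfun.rep_eq)

lemma csubspace_bounded_operators:
  "csubspace (bounded_operators :: ('a::complex_inner \<Rightarrow>\<^sub>L 'a) set)"
  by (auto simp: csubspace_def bounded_operators_def blinfun.add_left scaleC_add_right
      scaleC_scaleC mult.commute)

text \<open>This also guarantees that the intersection defining \<open>cstar_generated\<close> ranges over a nonempty
  family.\<close>

lemma cstar_subalgebra_bounded_operators: "cstar_subalgebra bounded_operators"
  unfolding cstar_subalgebra_def
  using csubspace_bounded_operators closed_bounded_operators adj_bounded_operators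
  by (auto simp: bounded_operators_def)

lemma cstar_subalgebra_cstar_generated:
  assumes "\<U> \<subseteq> bounded_operators"
  shows "cstar_subalgebra (cstar_generated \<U>)"
proof -
  have "cstar_generated \<U> \<subseteq> bounded_operators"
    using assms cstar_subalgebra_bounded_operators by (auto simp: cstar_generated_def)
  moreover have "closed (cstar_generated \<U>)"
    unfolding cstar_generated_def by (intro closed_Inter) (auto simp: cstar_subalgebra_def)
  ultimately show ?thesis
    unfolding cstar_subalgebra_def
    by (auto simp: cstar_generated_def cstar_subalgebra_def csubspace_def)
qed

lemma csubspace_Alg:
  assumes "\<L> \<subseteq> bounded_operators"
  shows "csubspace (Alg \<L>)"
proof -
  have "(id_blinfun - P) o\<^sub>L (c *\<^sub>C T) o\<^sub>L P = c *\<^sub>C ((id_blinfun - P) o\<^sub>L T o\<^sub>L P)"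
    if "P \<in> \<L>" for c P T
    using assms that
    by (intro blinfun_eqI) (auto simp: blinfun.diff_left bounded_operatorsD scaleC_right_diff)
  moreover have "(id_blinfun - P) o\<^sub>L (S + T) o\<^sub>L P =
      ((id_blinfun - P) o\<^sub>L S o\<^sub>L P) + ((id_blinfun - P) o\<^sub>L T o\<^sub>L P)" for P S T :: "'a \<Rightarrow>\<^sub>L 'a"
    by (intro blinfun_eqI) (simp add: blinfun.add_left blinfun.add_right)
  moreover have "c *\<^sub>C (0 :: 'a \<Rightarrow>\<^sub>L 'a) = 0" for c
    by (rule blinfun_eqI) simp
  ultimately show ?thesis
    using csubspace_bounded_operators by (auto simp: csubspace_def Alg_def)
qed

lemma closed_Alg: "closed (Alg \<L>)"
proof -
  have "Alg \<L> = bounded_operators \<inter> (\<Inter>P\<in>\<L>. {T. (id_blinfun - P) o\<^sub>L T o\<^sub>L P = 0})"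
    by (auto simp: Alg_def)
  moreover have "closed {T. (id_blinfun - P) o\<^sub>L T o\<^sub>L P = 0}" for P :: "'a \<Rightarrow>\<^sub>L 'a"
    by (intro closed_Collect_eq continuous_intros)
  ultimately show ?thesis
    using closed_bounded_operators by (simp only:) (intro closed_Int closed_INT ballI, assumption+)
qed

text \<open>Sandwiching \<open>T\<^sup>* T\<close> between rank-one operators returns a multiple of the rank-one operator
  itself, which moves from the ideal back into \<open>\<U>\<close>. Using \<open>T\<^sup>* T\<close> instead of \<open>T\<close> turns the scalar
  into \<open>\<parallel>T x\<parallel>\<^sup>2 \<parallel>y\<parallel>\<^sup>2\<close>, so that its vanishing forces \<open>T x = 0\<close> and not merely \<open>\<langle>T x, x\<rangle> = 0\<close>.\<close>

lemma ideal_annihilates_rank_one_range: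
  fixes \<U> :: "('a::chilbert_space \<Rightarrow>\<^sub>L 'a) set"
  assumes \<U>: "csubspace \<U>" "\<U> \<subseteq> bounded_operators"
    and J: "closed_ideal J (cstar_generated \<U>)" "\<U> \<inter> J = {0}"
    and a: "rank_one x y \<in> \<U>" "y \<noteq> 0"
    and T: "T \<in> J"
  shows "blinfun_apply T x = 0"
proof (rule ccontr)
  assume Tx: "blinfun_apply T x \<noteq> 0"
  let ?C = "cstar_generated \<U>"
  let ?a = "rank_one x y"
  have C: "cstar_subalgebra ?C"
    using \<U>(2) by (rule cstar_subalgebra_cstar_generated)
  have "T \<in> ?C"
    using T J(1) by (auto simp: closed_ideal_def)
  then have T': "T \<in> bounded_operators" "adj T \<in> ?C"
    using C by (auto simp: cstar_subalgebra_def)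
  have "?a \<in> ?C"
    using a(1) by (auto simp: cstar_generated_def)
  then have aC: "?a \<in> ?C" "rank_one y x \<in> ?C"
    using C adj_rank_one[of x y] by (auto simp: cstar_subalgebra_def)
  let ?b = "?a o\<^sub>L (rank_one y x o\<^sub>L ((adj T o\<^sub>L T) o\<^sub>L ?a))"
  define c where "c = cinner (blinfun_apply T x) (blinfun_apply T x) * cinner y y"
  have "cinner (blinfun_apply (adj T) (blinfun_apply T x)) x
      = cinner (blinfun_apply T x) (blinfun_apply T x)"
    by (metis cinner_adj[OF T'(1)] cinner_commute)
  then have b: "?b = c *\<^sub>C ?a"
    using T'(1) adj_bounded_operators[OF T'(1)]
    by (intro blinfun_eqI)
      (simp add: c_def bounded_operatorsD cinner_scaleC_left scaleC_scaleC mult_ac)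
  have "?b \<in> J"
    using J(1) T T'(2) aC by (simp add: closed_ideal_def)
  moreover have "?b \<in> \<U>"
    unfolding b using \<U>(1) a(1) by (simp add: csubspace_def)
  ultimately have "c *\<^sub>C ?a = 0"
    using J(2) b by auto
  then have "blinfun_apply (c *\<^sub>C ?a) y = 0"
    by simp
  then have "x = 0"
    using Tx a(2) by (simp add: c_def)
  then show False
    using Tx by (simp add: blinfun.zero_right)
qed

section \<open>The trivial intersection property\<close>

theorem corollary2p9:
  fixes \<L> :: "('a::chilbert_space \<Rightarrow>\<^sub>L 'a) set"
  assumes "commutative_subspace_lattice \<L>"
    and "completely_distributive (projection_lattice\<lparr>carrier := \<L>\<rparr>)"
  shows "trivial_intersection_property (Alg \<L>)"
proof -
  let ?L = "projection_lattice\<lparr>carrier := \<L>\<rparr>"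
  have \<L>: "\<L> \<subseteq> projections" "id_blinfun \<in> \<L>"
    and join: "\<And>A. A \<subseteq> \<L> \<Longrightarrow> \<Squnion>\<^bsub>projection_lattice\<^esub>A \<in> \<L>"
    using assms(1) by (auto simp: commutative_subspace_lattice_def)
  have Alg: "csubspace (Alg \<L>)" "Alg \<L> \<subseteq> bounded_operators"
    using csubspace_Alg[of \<L>] \<L>(1) by (auto simp: projections_def Alg_def)
  have le: "P \<sqsubseteq>\<^bsub>?L\<^esub> Q \<longleftrightarrow> range (blinfun_apply P) \<subseteq> range (blinfun_apply Q)" for P Q
    by (simp add: projection_lattice_def)
  have top: "P \<sqsubseteq>\<^bsub>?L\<^esub> id_blinfun" for P
    unfolding le by simp
  interpret L: complete_lattice ?L
    using assms(2) by (simp add: completely_distributive_def)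
  \<comment> \<open>\<open>pred E\<close> is the \<open>E\<^sub>-\<close> of the introduction\<close>
  define pred where "pred E = \<Squnion>\<^bsub>?L\<^esub>{Q \<in> \<L>. \<not> E \<sqsubseteq>\<^bsub>?L\<^esub> Q}" for E
  define G where "G = {E \<in> \<L>. pred E \<noteq> id_blinfun}"
  have G\<L>: "G \<subseteq> \<L>"
    by (auto simp: G_def)
  have "\<Squnion>\<^bsub>?L\<^esub>G = id_blinfun"
    using completely_distributive_top_join[OF assms(2) _ top] \<L>(2)
    by (simp add: G_def pred_def)
  have "J = {0}" if J: "closed_ideal J (cstar_generated (Alg \<L>))" "Alg \<L> \<inter> J = {0}" for J
  proof -
    have "T = 0" if T: "T \<in> J" for T
    proof -
      have kill: "blinfun_apply T x = 0" if E: "E \<in> G" and x: "x \<in> range (blinfun_apply E)" for E x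
      proof -
        have predE: "pred E \<in> \<L>"
          using L.sup_closed[of "{Q \<in> \<L>. \<not> E \<sqsubseteq>\<^bsub>?L\<^esub> Q}"] by (auto simp: pred_def)
        have "pred E \<noteq> id_blinfun"
          using E by (simp add: G_def)
        then obtain z where z: "blinfun_apply (pred E) z \<noteq> z"
          by (metis blinfun_eqI blinfun_apply_id_blinfun id_apply)
        define y where "y = z - blinfun_apply (pred E) z"
        have predp: "pred E \<in> projections"
          using predE \<L>(1) by blast
        have y: "y \<noteq> 0" "blinfun_apply (pred E) y = 0"
          using z projectionsD(1)[OF predp] by (auto simp: y_def blinfun.diff_right)
        have "blinfun_apply Q x = x \<or> blinfun_apply Q y = 0" if Q: "Q \<in> \<L>" for Q
        proof (cases "E \<sqsubseteq>\<^bsub>?L\<^esub> Q")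
          case True
          then show ?thesis
            using x Q \<L>(1) projection_range_iff le by blast
        next
          case False
          have Qp: "Q \<in> projections"
            using Q \<L>(1) by blast
          have "Q \<sqsubseteq>\<^bsub>?L\<^esub> pred E"
            unfolding pred_def using False Q by (intro L.sup_upper) auto
          then have "blinfun_apply (pred E) (blinfun_apply Q y) = blinfun_apply Q y"
            using projection_range_iff[OF predp] le by blast
          then have "cinner (blinfun_apply Q y) (blinfun_apply Q y)
              = cinner (blinfun_apply Q (blinfun_apply Q y)) (blinfun_apply (pred E) y)"
            by (metis projectionsD predp Qp)
          then show ?thesis
            using y(2) by simp
        qed
        then have "rank_one x y \<in> Alg \<L>"
          by (rule rank_one_in_Alg[OF \<L>(1)])
        then show ?thesis
          using ideal_annihilates_rank_one_range[OF Alg J _ y(1) T] by blast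
      qed
      have Tb: "T \<in> bounded_operators"
        using T J(1) cstar_subalgebra_cstar_generated[OF Alg(2)]
        by (auto simp: closed_ideal_def cstar_subalgebra_def)
      \<comment> \<open>The projection onto the kernel of \<open>T\<close> need not belong to \<open>\<L>\<close>, so it is compared with the
        join of \<open>G\<close> among all projections; that join does lie in \<open>\<L>\<close>.\<close>
      have "csubspace {x. blinfun_apply T x = 0}" "closed {x. blinfun_apply T x = 0}"
        using bounded_operatorsD[OF Tb]
        by (auto simp: csubspace_def blinfun.add_right blinfun.zero_right
            intro!: closed_Collect_eq continuous_intros)
      then obtain N where N: "N \<in> projections" "range (blinfun_apply N) = {x. blinfun_apply T x = 0}"
        using projection_onto_closed_subspace by blast
      let ?M = "\<Squnion>\<^bsub>projection_lattice\<^esub>G"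
      have Gp: "G \<subseteq> projections"
        using G\<L> \<L>(1) by blast
      have MN: "range (blinfun_apply ?M) \<subseteq> range (blinfun_apply N)"
        using N kill by (intro projection_lattice_join_least[OF Gp]) auto
      have "E \<sqsubseteq>\<^bsub>?L\<^esub> ?M" if "E \<in> G" for E
        using projection_lattice_join_upper[OF Gp that] by (simp only: le)
      then have "\<Squnion>\<^bsub>?L\<^esub>G \<sqsubseteq>\<^bsub>?L\<^esub> ?M"
        using G\<L> join by (intro L.sup_least) auto
      then have "range (blinfun_apply id_blinfun) \<subseteq> range (blinfun_apply ?M)"
        by (simp only: le \<open>\<Squnion>\<^bsub>?L\<^esub>G = id_blinfun\<close>)
      then have "x \<in> range (blinfun_apply ?M)" for x
        by auto
      then have "blinfun_apply T x = 0" for x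
        using MN N(2) by blast
      then show "T = 0"
        by (intro blinfun_eqI) simp
    qed
    moreover have "0 \<in> J"
      using J(2) by blast
    ultimately show ?thesis
      by blast
  qed
  then show ?thesis
    using Alg closed_Alg by (auto simp: trivial_intersection_property_def)
qed

end
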